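(* Let $(X,\rho)$ be a $b_v(s)$-metric space, where $v\in\mathbb{N}$ and $s\in[1,\infty)$. Assume that every mapping $T:X\to X$ for which there exist $b,c\in[0,\infty)$ with $b+c=1$ such that $$\rho(Tx,Ty)<b\,\rho(x,Tx)+c\,\rho(y,Ty)\quad\text{for all }x,y\in X\text{ with }x\neq y$$ has a unique fixed point. Then $(X,\rho)$ is complete.
   Context: Let $X$ be a non-empty set, $v\in\mathbb{N}$ and $s\in[1,\infty)$. A function $\rho:X\times X\to\mathbb{R}$ is a $b_v(s)$-metric, and $(X,\rho)$ is a $b_v(s)$-metric space, if for all $x,y\in X$ and for all distinct points $u_1,\dots,u_v\in X$, each of them different from $x$ and $y$: (i) $\rho(x,y)\ge 0$, and $\rho(x,y)=0$ if and only if $x=y$; (ii) $\rho(x,y)=\rho(y,x)$; (iii) $\rho(x,y)\le s\left[\rho(x,u_1)+\rho(u_1,u_2)+\cdots+\rho(u_v,y)\right]$. A sequence $\{x_n\}$ in $X$ converges to $x\in X$ if $\rho(x_n,x)\to 0$ as $n\to\infty$; it is Cauchy if $\rho(x_n,x_m)\to 0$ as $n,m\to\infty$. The space $(X,\rho)$ is complete if every Cauchy sequence in $X$ converges to some point of $X$. *)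

theory Defs
  imports Complex_Main "HOL-Library.FuncSet"
begin

text \<open>Here v ranges over the positive integers: v = 1 gives b-metric spaces, and the chain
  \<open>u 1, \<dots>, u v\<close> in the polygon inequality always has at least one point.
  Only the values of \<open>\<rho>\<close> on \<open>X \<times> X\<close> and of \<open>u\<close> on \<open>{1..v}\<close> matter.\<close>

locale bvs_metric_space =
  fixes v :: nat and s :: real and X :: "'a set" and \<rho> :: "'a \<Rightarrow> 'a \<Rightarrow> real"
  assumes v_pos: "1 \<le> v"
    and s_ge_1: "1 \<le> s"
    and nonempty: "X \<noteq> {}"
    and nonneg: "\<lbrakk>x \<in> X; y \<in> X\<rbrakk> \<Longrightarrow> 0 \<le> \<rho> x y"
    and eq_zero_iff: "\<lbrakk>x \<in> X; y \<in> X\<rbrakk> \<Longrightarrow> \<rho> x y = 0 \<longleftrightarrow> x = y"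
    and symmetric: "\<lbrakk>x \<in> X; y \<in> X\<rbrakk> \<Longrightarrow> \<rho> x y = \<rho> y x"
    and polygon: "\<lbrakk>x \<in> X; y \<in> X; u \<in> {1..v} \<rightarrow> X - {x, y}; inj_on u {1..v}\<rbrakk>
      \<Longrightarrow> \<rho> x y \<le> s * (\<rho> x (u 1) + (\<Sum>i = 1..<v. \<rho> (u i) (u (Suc i))) + \<rho> (u v) y)"

definition bvs_converges_to :: "('a \<Rightarrow> 'a \<Rightarrow> real) \<Rightarrow> (nat \<Rightarrow> 'a) \<Rightarrow> 'a \<Rightarrow> bool" where
  "bvs_converges_to \<rho> \<sigma> l \<longleftrightarrow> (\<lambda>n. \<rho> (\<sigma> n) l) \<longlonglongrightarrow> 0"

definition bvs_Cauchy :: "('a \<Rightarrow> 'a \<Rightarrow> real) \<Rightarrow> (nat \<Rightarrow> 'a) \<Rightarrow> bool" where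
  "bvs_Cauchy \<rho> \<sigma> \<longleftrightarrow>
    ((\<lambda>(n, m). \<rho> (\<sigma> n) (\<sigma> m)) \<longlongrightarrow> 0) (sequentially \<times>\<^sub>F sequentially)"

definition bvs_complete :: "'a set \<Rightarrow> ('a \<Rightarrow> 'a \<Rightarrow> real) \<Rightarrow> bool" where
  "bvs_complete X \<rho> \<longleftrightarrow>
    (\<forall>\<sigma>. range \<sigma> \<subseteq> X \<and> bvs_Cauchy \<rho> \<sigma> \<longrightarrow> (\<exists>l\<in>X. bvs_converges_to \<rho> \<sigma> l))"

end

theory Submission
  imports Defs
begin

text \<open>Suppose that a Cauchy sequence \<open>\<sigma>\<close> in \<open>X\<close> has no limit in \<open>X\<close>. The heart of the matter is that
  then no point of \<open>X\<close> is even a cluster point of \<open>\<sigma>\<close>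
  (\<open>cluster_point_imp_convergent\<close>), so each \<open>x \<in> X\<close> has a positive distance from some tail of
  \<open>\<sigma>\<close>, whereas the diameters of the tails tend to \<open>0\<close>. Hence each \<open>x\<close> has an index \<open>k x\<close> such that
  \<open>\<sigma> (k x)\<close> is less than half as far from all later terms as it is from \<open>x\<close>
  (\<open>nonconvergent_Cauchy_escape\<close>). The map \<open>T x = \<sigma> (k x)\<close> moves every point, and for any \<open>x\<close>, \<open>y\<close>
  the distance of \<open>T x\<close> and \<open>T y\<close> is less than half of \<open>\<rho> x (T x)\<close> or of \<open>\<rho> y (T y)\<close>, according to
  which of \<open>k x\<close>, \<open>k y\<close> is smaller. So \<open>T\<close> satisfies the contractive condition with
  \<open>b = c = 1/2\<close> and has no fixed point, contrary to the hypothesis.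

  As the polygon inequality needs \<open>v\<close> distinct intermediate points, the usual argument that a Cauchy
  sequence converges to its cluster points applies only if \<open>\<sigma>\<close> takes infinitely many values; otherwise
  some value recurs, and a recurring value is a limit.\<close>

lemma bvs_Cauchy_tail:
  assumes "bvs_Cauchy \<rho> \<sigma>" and "0 < e"
  obtains N where "\<And>m n. N \<le> m \<Longrightarrow> N \<le> n \<Longrightarrow> \<rho> (\<sigma> m) (\<sigma> n) < e"
proof -
  have "\<forall>\<^sub>F p in sequentially \<times>\<^sub>F sequentially. (case p of (n, m) \<Rightarrow> \<rho> (\<sigma> n) (\<sigma> m)) < e"
    using assms unfolding bvs_Cauchy_def by (rule order_tendstoD(2))
  then show ?thesis
    using that by (auto simp: eventually_prod_sequentially)
qed

context bvs_metric_space
begin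

lemma bvs_converges_toI:
  assumes "range \<sigma> \<subseteq> X" and "l \<in> X"
    and "\<And>e. 0 < e \<Longrightarrow> \<exists>N. \<forall>n\<ge>N. \<rho> (\<sigma> n) l < e"
  shows "bvs_converges_to \<rho> \<sigma> l"
  unfolding bvs_converges_to_def
proof (rule LIMSEQ_I)
  fix e :: real
  assume "0 < e"
  moreover have "0 \<le> \<rho> (\<sigma> n) l" for n
    using assms(1,2) nonneg by blast
  ultimately show "\<exists>N. \<forall>n\<ge>N. norm (\<rho> (\<sigma> n) l - 0) < e"
    using assms(3) by simp
qed

lemma recurring_value_imp_convergent:
  assumes "range \<sigma> \<subseteq> X" and "bvs_Cauchy \<rho> \<sigma>" and inf: "infinite (\<sigma> -` {p})"
  shows "p \<in> X" and "bvs_converges_to \<rho> \<sigma> p"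
proof -
  have recur: "\<exists>m\<ge>N. \<sigma> m = p" for N
    using inf by (force simp: finite_nat_set_iff_bounded not_less)
  then show "p \<in> X"
    using assms(1) by blast
  then show "bvs_converges_to \<rho> \<sigma> p"
  proof (rule bvs_converges_toI[OF assms(1)])
    fix e :: real
    assume "0 < e"
    then obtain N where "\<And>m n. N \<le> m \<Longrightarrow> N \<le> n \<Longrightarrow> \<rho> (\<sigma> m) (\<sigma> n) < e"
      using bvs_Cauchy_tail[OF assms(2)] by blast
    then show "\<exists>N. \<forall>n\<ge>N. \<rho> (\<sigma> n) p < e"
      using recur[of N] by blast
  qed
qed

text \<open>The polygon inequality in the form in which a Cauchy tail supplies it: an infinite set of
  mutually close points provides all the distinct intermediate points, and only the first of them,
  \<open>p\<close>, has to be near \<open>x\<close>.\<close>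

lemma polygon_through_infinite_set:
  assumes "x \<in> X" "y \<in> A" "p \<in> A" "A \<subseteq> X" "infinite A"
    and close: "\<And>a b. a \<in> A \<Longrightarrow> b \<in> A \<Longrightarrow> \<rho> a b < d"
    and "\<rho> x p < d" "p \<noteq> x" "p \<noteq> y"
  shows "\<rho> x y \<le> s * ((real v + 1) * d)"
proof -
  have "infinite (A - {x, y, p})"
    using \<open>infinite A\<close> by simp
  then obtain f :: "nat \<Rightarrow> 'a" where f: "inj f" "range f \<subseteq> A - {x, y, p}"
    using infinite_countable_subset by blast
  define u where "u i = (if i = 1 then p else f i)" for i :: nat
  have uA: "u i \<in> A - {x, y}" for i
    using f(2) assms(3,8,9) by (auto simp: u_def)
  have "p \<noteq> f i" for i
    using f(2) by blast
  then have "inj_on u {1..v}"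
    using f(1) by (auto simp: inj_on_def u_def)
  then have "\<rho> x y \<le> s * (\<rho> x (u 1) + (\<Sum>i = 1..<v. \<rho> (u i) (u (Suc i))) + \<rho> (u v) y)"
    using assms(1,2,4) uA by (intro polygon) auto
  also have "\<dots> \<le> s * (d + (real v - 1) * d + d)"
  proof (rule mult_left_mono)
    have "(\<Sum>i = 1..<v. \<rho> (u i) (u (Suc i))) \<le> (\<Sum>i = 1..<v. d)"
      using uA close by (intro sum_mono less_imp_le) blast
    also have "\<dots> = (real v - 1) * d"
      using v_pos by (simp add: of_nat_diff)
    finally have "(\<Sum>i = 1..<v. \<rho> (u i) (u (Suc i))) \<le> (real v - 1) * d" .
    moreover have "\<rho> x (u 1) < d"
      using assms(7) by (simp add: u_def)
    moreover have "\<rho> (u v) y < d"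
      using uA[of v] assms(2) close by blast
    ultimately show "\<rho> x (u 1) + (\<Sum>i = 1..<v. \<rho> (u i) (u (Suc i))) + \<rho> (u v) y
        \<le> d + (real v - 1) * d + d"
      by linarith
  qed (use s_ge_1 in simp)
  also have "\<dots> = s * ((real v + 1) * d)"
    by (simp add: algebra_simps)
  finally show ?thesis .
qed

text \<open>Only the existence of a limit is claimed, so that a recurring value may serve as the limit;
  without recurring values every tail takes infinitely many values and the polygon inequality yields
  convergence to the cluster point itself.\<close>

lemma cluster_point_imp_convergent:
  assumes ran: "range \<sigma> \<subseteq> X" and Cauchy: "bvs_Cauchy \<rho> \<sigma>" and "l \<in> X"
    and cluster: "\<And>e N. 0 < e \<Longrightarrow> \<exists>n\<ge>N. \<rho> (\<sigma> n) l < e"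
  shows "\<exists>l\<in>X. bvs_converges_to \<rho> \<sigma> l"
proof (cases "\<exists>p. infinite (\<sigma> -` {p})")
  case True
  then show ?thesis
    using recurring_value_imp_convergent[OF ran Cauchy] by blast
next
  case False
  then have fin: "finite (\<sigma> -` {p})" for p
    by blast
  have inf: "infinite (\<sigma> ` {N..})" for N
  proof
    assume "finite (\<sigma> ` {N..})"
    then have "finite (\<Union>p\<in>\<sigma> ` {N..}. \<sigma> -` {p})"
      using fin by blast
    moreover have "{N..} \<subseteq> (\<Union>p\<in>\<sigma> ` {N..}. \<sigma> -` {p})"
      by auto
    ultimately show False
      using infinite_Ici finite_subset by blast
  qed
  have "bvs_converges_to \<rho> \<sigma> l"
  proof (rule bvs_converges_toI[OF ran \<open>l \<in> X\<close>])
    fix e :: real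
    assume "0 < e"
    \<comment> \<open>The chain has \<open>v + 1\<close> links; the additional one leaves room for strict bounds.\<close>
    define d where "d = e / (s * (real v + 2))"
    have pos: "0 < s * (real v + 2)"
      using s_ge_1 by simp
    then have "0 < d"
      using \<open>0 < e\<close> by (simp add: d_def)
    have "e = s * (real v + 2) * d"
      using pos s_ge_1 by (simp add: d_def)
    then have e: "e = s * (real v + 1) * d + s * d"
      by (simp add: algebra_simps)
    have "d \<le> s * d"
      using s_ge_1 \<open>0 < d\<close> by simp
    moreover have "0 < s * (real v + 1) * d"
      using s_ge_1 \<open>0 < d\<close> by simp
    ultimately have "d < e" and chain: "s * ((real v + 1) * d) < e"
      using \<open>0 < d\<close> e unfolding mult.assoc by linarith+
    obtain N where N: "\<And>m n. N \<le> m \<Longrightarrow> N \<le> n \<Longrightarrow> \<rho> (\<sigma> m) (\<sigma> n) < d"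
      using bvs_Cauchy_tail[OF Cauchy \<open>0 < d\<close>] by blast
    obtain M where M: "\<And>m. M \<le> m \<Longrightarrow> \<sigma> m \<noteq> l"
      using fin[of l] unfolding finite_nat_set_iff_bounded
      by (metis not_less vimage_singleton_eq)
    obtain m where m: "max M N \<le> m" "\<rho> (\<sigma> m) l < d"
      using cluster[OF \<open>0 < d\<close>] by blast
    have X: "\<sigma> i \<in> X" for i
      using ran by blast
    have "\<rho> (\<sigma> n) l < e" if "N \<le> n" for n
    proof (cases "\<sigma> n = \<sigma> m")
      case True
      then show ?thesis
        using m(2) \<open>d < e\<close> by simp
    next
      case False
      have "\<rho> l (\<sigma> n) \<le> s * ((real v + 1) * d)"
      proof (rule polygon_through_infinite_set)
        show "infinite (\<sigma> ` {N..})"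
          by (rule inf)
        show "\<rho> l (\<sigma> m) < d"
          using m(2) symmetric[OF \<open>l \<in> X\<close> X] by simp
      qed (use m N M X False that \<open>l \<in> X\<close> in auto)
      then show ?thesis
        using chain symmetric[OF \<open>l \<in> X\<close> X] by simp
    qed
    then show "\<exists>N. \<forall>n\<ge>N. \<rho> (\<sigma> n) l < e"
      by blast
  qed
  then show ?thesis
    using \<open>l \<in> X\<close> by blast
qed

text \<open>As \<open>x\<close> is not a cluster point, \<open>\<rho> x (\<sigma> k)\<close> stays above a fixed positive bound for large \<open>k\<close>,
  while the tail beyond \<open>k\<close> shrinks. Taking \<open>m = k\<close> in the conclusion shows that \<open>\<sigma> k \<noteq> x\<close>.\<close>

lemma nonconvergent_Cauchy_escape:
  assumes ran: "range \<sigma> \<subseteq> X" and Cauchy: "bvs_Cauchy \<rho> \<sigma>"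
    and nonconv: "\<not> (\<exists>l\<in>X. bvs_converges_to \<rho> \<sigma> l)" and "x \<in> X"
  shows "\<exists>k. \<forall>m\<ge>k. \<rho> (\<sigma> k) (\<sigma> m) < \<rho> x (\<sigma> k) / 2"
proof -
  obtain e M where "0 < e" and M: "\<And>n. M \<le> n \<Longrightarrow> e \<le> \<rho> (\<sigma> n) x"
    using cluster_point_imp_convergent[OF ran Cauchy \<open>x \<in> X\<close>] nonconv by (meson not_less)
  then obtain N where N: "\<And>m n. N \<le> m \<Longrightarrow> N \<le> n \<Longrightarrow> \<rho> (\<sigma> m) (\<sigma> n) < e / 2"
    using bvs_Cauchy_tail[OF Cauchy, of "e / 2"] by auto
  have "\<rho> (\<sigma> (max M N)) (\<sigma> m) < \<rho> x (\<sigma> (max M N)) / 2" if "max M N \<le> m" for m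
  proof -
    have "\<rho> (\<sigma> (max M N)) (\<sigma> m) < e / 2"
      using N that by simp
    also have "\<dots> \<le> \<rho> (\<sigma> (max M N)) x / 2"
      using M by simp
    also have "\<dots> = \<rho> x (\<sigma> (max M N)) / 2"
      using symmetric[of x "\<sigma> (max M N)"] ran \<open>x \<in> X\<close> by (simp add: range_subsetD)
    finally show ?thesis .
  qed
  then show ?thesis
    by blast
qed

end

theorem theorem2p15:
  fixes v :: nat and s :: real and X :: "'a set" and \<rho> :: "'a \<Rightarrow> 'a \<Rightarrow> real"
  assumes "bvs_metric_space v s X \<rho>"
    and "\<And>T :: 'a \<Rightarrow> 'a. T \<in> X \<rightarrow> X \<Longrightarrow>
      \<exists>b c :: real. 0 \<le> b \<and> 0 \<le> c \<and> b + c = 1 \<and>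
        (\<forall>x\<in>X. \<forall>y\<in>X. x \<noteq> y \<longrightarrow> \<rho> (T x) (T y) < b * \<rho> x (T x) + c * \<rho> y (T y)) \<Longrightarrow>
      \<exists>!x. x \<in> X \<and> T x = x"
  shows "bvs_complete X \<rho>"
proof (rule ccontr)
  interpret bvs_metric_space v s X \<rho> by fact
  assume "\<not> bvs_complete X \<rho>"
  then obtain \<sigma> where ran: "range \<sigma> \<subseteq> X" and Cauchy: "bvs_Cauchy \<rho> \<sigma>"
    and nonconv: "\<not> (\<exists>l\<in>X. bvs_converges_to \<rho> \<sigma> l)"
    unfolding bvs_complete_def by blast
  obtain k where k: "\<And>x m. x \<in> X \<Longrightarrow> k x \<le> m \<Longrightarrow> \<rho> (\<sigma> (k x)) (\<sigma> m) < \<rho> x (\<sigma> (k x)) / 2"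
    using nonconvergent_Cauchy_escape[OF ran Cauchy nonconv] by metis
  define T where "T x = \<sigma> (k x)" for x
  have TX: "T x \<in> X" for x
    using ran by (auto simp: T_def)
  have moves: "0 < \<rho> x (T x)" if "x \<in> X" for x
    using k[OF that order_refl] eq_zero_iff[OF TX TX, of x x] by (simp add: T_def)
  have half: "\<rho> (T x) (T y) < \<rho> x (T x) / 2" if "x \<in> X" "k x \<le> k y" for x y
    using k[OF that] by (simp add: T_def)
  have contractive: "\<rho> (T x) (T y) < 1/2 * \<rho> x (T x) + 1/2 * \<rho> y (T y)"
    if "x \<in> X" "y \<in> X" for x y
  proof (cases "k x \<le> k y")
    case True
    then show ?thesis
      using half[OF that(1) True] moves[OF that(2)] by simp
  next
    case False
    then show ?thesis
      using half[of y x] that moves[OF that(1)] symmetric[OF TX TX, of x y] by simp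
  qed
  have "\<exists>!x. x \<in> X \<and> T x = x"
  proof (rule assms(2))
    show "T \<in> X \<rightarrow> X"
      using TX by blast
    show "\<exists>b c :: real. 0 \<le> b \<and> 0 \<le> c \<and> b + c = 1 \<and>
        (\<forall>x\<in>X. \<forall>y\<in>X. x \<noteq> y \<longrightarrow> \<rho> (T x) (T y) < b * \<rho> x (T x) + c * \<rho> y (T y))"
      by (rule exI[of _ "1/2"], rule exI[of _ "1/2"]) (use contractive in simp)
  qed
  then obtain x where "x \<in> X" "T x = x"
    by blast
  then show False
    using moves[of x] eq_zero_iff[of x x] by simp
qed

end
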